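(* Let $S$ be an intra-regular $\Gamma$-AG$^{\ast\ast}$-groupoid and let $A=(\mu_A,\gamma_A)$ be an intuitionistic fuzzy set of $S$. Then the following conditions are equivalent. (i) $A$ is an intuitionistic fuzzy $\Gamma$-interior ideal of $S$. (ii) $(\delta\circ_\Gamma A)\circ_\Gamma\delta=A$, where $\delta=(S_\delta,\Theta_\delta)$.
   Context: Let $S,\Gamma$ be nonempty sets with a map $S\times\Gamma\times S\to S$, $(x,\alpha,y)\mapsto x\alpha y$. $S$ is a $\Gamma$-AG-groupoid if $(x\alpha y)\beta z=(z\alpha y)\beta x$ for all $x,y,z\in S$, $\alpha,\beta\in\Gamma$. It is a $\Gamma$-AG$^{\ast\ast}$-groupoid if moreover $x\alpha(y\beta z)=y\alpha(x\beta z)$ for all $x,y,z\in S$, $\alpha,\beta\in\Gamma$. $S$ is intra-regular if for every $a\in S$ there exist $x,y\in S$ and $\alpha,\beta,\gamma\in\Gamma$ with $a=(x\alpha(a\beta a))\gamma y$. An intuitionistic fuzzy set (IFS) of $S$ is a pair $A=(\mu_A,\gamma_A)$ of functions $\mu_A,\gamma_A:S\to[0,1]$ with $0\le\mu_A(x)+\gamma_A(x)\le1$ for all $x\in S$. Let $\delta=(S_\delta,\Theta_\delta)$ be the IFS with $S_\delta(x)=1$, $\Theta_\delta(x)=0$ for all $x$. The product $A\circ_\Gamma B=(\mu_A\circ_\Gamma\mu_B,\gamma_A\circ_\Gamma\gamma_B)$ is given by $(\mu_A\circ_\Gamma\mu_B)(a)=\sup\{\mu_A(b)\wedge\mu_B(c)\}$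 and $(\gamma_A\circ_\Gamma\gamma_B)(a)=\inf\{\gamma_A(b)\vee\gamma_B(c)\}$, over all $b,c\in S$, $\beta\in\Gamma$ with $a=b\beta c$, if such a factorization exists, and by $0$ and $1$ respectively otherwise. Here $\wedge=\min$, $\vee=\max$. An IFS $A$ of $S$ is an intuitionistic fuzzy $\Gamma$-interior ideal if $\mu_A((x\alpha a)\beta y)\ge\mu_A(a)$ and $\gamma_A((x\alpha a)\beta y)\le\gamma_A(a)$ for all $x,a,y\in S$ and $\alpha,\beta\in\Gamma$. *)

theory Defs
  imports Complex_Main "HOL-Library.FuncSet"
begin

locale gamma_AG_groupoid =
  fixes S :: "'s set" and \<Gamma> :: "'g set" and op :: "'s \<Rightarrow> 'g \<Rightarrow> 's \<Rightarrow> 's"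
  assumes S_nonempty: "S \<noteq> {}"
    and Gamma_nonempty: "\<Gamma> \<noteq> {}"
    and op_closed: "\<lbrakk>x \<in> S; \<alpha> \<in> \<Gamma>; y \<in> S\<rbrakk> \<Longrightarrow> op x \<alpha> y \<in> S"
    and left_invertive:
      "\<lbrakk>x \<in> S; y \<in> S; z \<in> S; \<alpha> \<in> \<Gamma>; \<beta> \<in> \<Gamma>\<rbrakk>
        \<Longrightarrow> op (op x \<alpha> y) \<beta> z = op (op z \<alpha> y) \<beta> x"

locale gamma_AG_star_star_groupoid = gamma_AG_groupoid S \<Gamma> op
  for S :: "'s set" and \<Gamma> :: "'g set" and op :: "'s \<Rightarrow> 'g \<Rightarrow> 's \<Rightarrow> 's" +
  assumes star_star:
    "\<lbrakk>x \<in> S; y \<in> S; z \<in> S; \<alpha> \<in> \<Gamma>; \<beta> \<in> \<Gamma>\<rbrakk>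
      \<Longrightarrow> op x \<alpha> (op y \<beta> z) = op y \<alpha> (op x \<beta> z)"

definition intra_regular :: "'s set \<Rightarrow> 'g set \<Rightarrow> ('s \<Rightarrow> 'g \<Rightarrow> 's \<Rightarrow> 's) \<Rightarrow> bool" where
  "intra_regular S \<Gamma> op \<longleftrightarrow>
    (\<forall>a\<in>S. \<exists>x\<in>S. \<exists>y\<in>S. \<exists>\<alpha>\<in>\<Gamma>. \<exists>\<beta>\<in>\<Gamma>. \<exists>\<gamma>\<in>\<Gamma>.
      a = op (op x \<alpha> (op a \<beta> a)) \<gamma> y)"

text \<open>
  An intuitionistic fuzzy set is the pair of its membership and non-membership functions. Both are
  extensional functions on the carrier (undefined outside of it), as are the functions built by the
  operations below, so that equality of pairs is equality of intuitionistic fuzzy sets of the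
  carrier.
\<close>

type_synonym 's ifs = "('s \<Rightarrow> real) \<times> ('s \<Rightarrow> real)"

definition is_ifs :: "'s set \<Rightarrow> 's ifs \<Rightarrow> bool" where
  "is_ifs S A \<longleftrightarrow>
    fst A \<in> S \<rightarrow>\<^sub>E {0..1} \<and> snd A \<in> S \<rightarrow>\<^sub>E {0..1} \<and>
    (\<forall>x\<in>S. 0 \<le> fst A x + snd A x \<and> fst A x + snd A x \<le> 1)"

definition ifs_delta :: "'s set \<Rightarrow> 's ifs" where
  "ifs_delta S = ((\<lambda>x\<in>S. 1), (\<lambda>x\<in>S. 0))"

definition mu_prod ::
  "'s set \<Rightarrow> 'g set \<Rightarrow> ('s \<Rightarrow> 'g \<Rightarrow> 's \<Rightarrow> 's) \<Rightarrow> ('s \<Rightarrow> real) \<Rightarrow> ('s \<Rightarrow> real) \<Rightarrow> 's \<Rightarrow> real" where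
  "mu_prod S \<Gamma> op f g = (\<lambda>a\<in>S.
    if \<exists>b\<in>S. \<exists>c\<in>S. \<exists>\<beta>\<in>\<Gamma>. a = op b \<beta> c
    then Sup {min (f b) (g c) | b c \<beta>. b \<in> S \<and> c \<in> S \<and> \<beta> \<in> \<Gamma> \<and> a = op b \<beta> c}
    else 0)"

definition gamma_prod ::
  "'s set \<Rightarrow> 'g set \<Rightarrow> ('s \<Rightarrow> 'g \<Rightarrow> 's \<Rightarrow> 's) \<Rightarrow> ('s \<Rightarrow> real) \<Rightarrow> ('s \<Rightarrow> real) \<Rightarrow> 's \<Rightarrow> real" where
  "gamma_prod S \<Gamma> op f g = (\<lambda>a\<in>S.
    if \<exists>b\<in>S. \<exists>c\<in>S. \<exists>\<beta>\<in>\<Gamma>. a = op b \<beta> c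
    then Inf {max (f b) (g c) | b c \<beta>. b \<in> S \<and> c \<in> S \<and> \<beta> \<in> \<Gamma> \<and> a = op b \<beta> c}
    else 1)"

definition ifs_prod ::
  "'s set \<Rightarrow> 'g set \<Rightarrow> ('s \<Rightarrow> 'g \<Rightarrow> 's \<Rightarrow> 's) \<Rightarrow> 's ifs \<Rightarrow> 's ifs \<Rightarrow> 's ifs" where
  "ifs_prod S \<Gamma> op A B =
    (mu_prod S \<Gamma> op (fst A) (fst B), gamma_prod S \<Gamma> op (snd A) (snd B))"

definition if_interior_ideal ::
  "'s set \<Rightarrow> 'g set \<Rightarrow> ('s \<Rightarrow> 'g \<Rightarrow> 's \<Rightarrow> 's) \<Rightarrow> 's ifs \<Rightarrow> bool" where
  "if_interior_ideal S \<Gamma> op A \<longleftrightarrow> is_ifs S A \<and>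
    (\<forall>x\<in>S. \<forall>a\<in>S. \<forall>y\<in>S. \<forall>\<alpha>\<in>\<Gamma>. \<forall>\<beta>\<in>\<Gamma>.
      fst A (op (op x \<alpha> a) \<beta> y) \<ge> fst A a \<and>
      snd A (op (op x \<alpha> a) \<beta> y) \<le> snd A a)"

end

(* In an intra-regular AG**-groupoid, a = (x(aa))y = (y(xa))a by the two laws, hence
   aa = ((y(xa))a)a. So an interior ideal has A(aa) >= A(a), and the factorization a = (x(aa))y
   shows that the supremum defining (delta A) delta at a is at least A(a).
   The non-membership half follows from the membership half by passing to 1 - f. *)
theory Submission
  imports Defs
begin

text \<open>A real \<open>Sup\<close> dominates its members only when the set is bounded above; the
  bound on \<open>f\<close> provides this, as every minimum is at most
  \<open>f b \<le> 1\<close>.\<close>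

lemma mu_prod_upper:
  assumes "op b \<beta> c \<in> S" "b \<in> S" "c \<in> S" "\<beta> \<in> \<Gamma>"
    and "f \<in> S \<rightarrow> {0..1::real}"
  shows "min (f b) (g c) \<le> mu_prod S \<Gamma> op f g (op b \<beta> c)"
proof -
  let ?X = "{min (f b') (g c') | b' c' \<beta>'. b' \<in> S \<and> c' \<in> S \<and> \<beta>' \<in> \<Gamma> \<and> op b \<beta> c = op b' \<beta>' c'}"
  have "bdd_above ?X"
    using assms(5) by (intro bdd_aboveI[of _ 1]) (force simp: Pi_iff min_le_iff_disj)
  moreover have "min (f b) (g c) \<in> ?X"
    using assms by blast
  ultimately have "min (f b) (g c) \<le> Sup ?X"
    by (rule cSup_upper[rotated])
  then show ?thesis
    using assms unfolding mu_prod_def by auto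
qed

text \<open>The assumption \<open>0 \<le> u\<close> covers an \<open>a\<close> without a
  factorization, where the product takes its default value 0.\<close>

lemma mu_prod_least:
  assumes "a \<in> S" "0 \<le> u"
    and "\<And>b c \<beta>. b \<in> S \<Longrightarrow> c \<in> S \<Longrightarrow> \<beta> \<in> \<Gamma> \<Longrightarrow> a = op b \<beta> c \<Longrightarrow> min (f b) (g c) \<le> u"
  shows "mu_prod S \<Gamma> op f g a \<le> u"
proof (cases "\<exists>b\<in>S. \<exists>c\<in>S. \<exists>\<beta>\<in>\<Gamma>. a = op b \<beta> c")
  case True
  then have "Sup {min (f b) (g c) | b c \<beta>. b \<in> S \<and> c \<in> S \<and> \<beta> \<in> \<Gamma> \<and> a = op b \<beta> c} \<le> u"
    using assms(3) by (intro cSup_least) blast+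
  then show ?thesis
    using True assms(1) unfolding mu_prod_def by simp
next
  case False
  then show ?thesis
    using assms(1,2) unfolding mu_prod_def by simp
qed

lemma mu_prod_in_unit_interval:
  assumes f: "f \<in> S \<rightarrow> {0..1}" and g: "g \<in> S \<rightarrow> {0..1}"
  shows "mu_prod S \<Gamma> op f g \<in> S \<rightarrow>\<^sub>E {0..1}"
proof (intro PiE_I)
  fix a assume a: "a \<in> S"
  have "mu_prod S \<Gamma> op f g a \<le> 1"
    using a f by (intro mu_prod_least) (auto simp: Pi_iff min_le_iff_disj)
  moreover have "0 \<le> mu_prod S \<Gamma> op f g a"
  \<comment> \<open>With a factorization, one nonnegative member already bounds the supremum from
    below; otherwise the value is the default 0.\<close>
  proof (cases "\<exists>b\<in>S. \<exists>c\<in>S. \<exists>\<beta>\<in>\<Gamma>. a = op b \<beta> c")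
    case True
    then obtain b c \<beta> where *: "b \<in> S" "c \<in> S" "\<beta> \<in> \<Gamma>" "a = op b \<beta> c"
      by blast
    have "0 \<le> min (f b) (g c)"
      using * f g by (auto simp: Pi_iff)
    also have "\<dots> \<le> mu_prod S \<Gamma> op f g a"
      using mu_prod_upper[of op b \<beta> c S \<Gamma> f g] * a f by simp
    finally show ?thesis .
  next
    case False
    then show ?thesis
      using a unfolding mu_prod_def by simp
  qed
  ultimately show "mu_prod S \<Gamma> op f g a \<in> {0..1}"
    by simp
qed (simp add: mu_prod_def)

text \<open>The map t \<mapsto> 1 - t is continuous and antitone, so it carries suprema to
  infima.\<close>

lemma one_minus_Sup:
  fixes X :: "real set"
  assumes "X \<noteq> {}" "bdd_above X"
  shows "1 - Sup X = Inf ((-) 1 ` X)"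
  by (rule continuous_at_Sup_antimono) (use assms in \<open>auto simp: antimono_def intro!: continuous_intros\<close>)

text \<open>Restricting to \<open>S\<close> keeps the complement extensional, so that it is an
  involution on extensional functions.\<close>

definition fuzzy_compl :: "'s set \<Rightarrow> ('s \<Rightarrow> real) \<Rightarrow> 's \<Rightarrow> real" where
  "fuzzy_compl S f = (\<lambda>x\<in>S. 1 - f x)"

lemma fuzzy_compl_fuzzy_compl:
  "f \<in> extensional S \<Longrightarrow> fuzzy_compl S (fuzzy_compl S f) = f"
  unfolding fuzzy_compl_def by (auto simp: fun_eq_iff extensional_def)

lemma fuzzy_compl_in_unit_interval:
  "f \<in> S \<rightarrow> {0..1} \<Longrightarrow> fuzzy_compl S f \<in> S \<rightarrow>\<^sub>E {0..1}"
  unfolding fuzzy_compl_def by (auto simp: Pi_iff)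

text \<open>De Morgan duality: t \<mapsto> 1 - t exchanges min with max, \<open>Sup\<close> with
  \<open>Inf\<close>, and the default values 0 and 1.\<close>

lemma gamma_prod_eq_compl_mu_prod:
  assumes f: "f \<in> S \<rightarrow> {0..1}" and g: "g \<in> S \<rightarrow> {0..1}"
  shows "gamma_prod S \<Gamma> op f g =
    fuzzy_compl S (mu_prod S \<Gamma> op (fuzzy_compl S f) (fuzzy_compl S g))"
proof
  fix a
  show "gamma_prod S \<Gamma> op f g a =
    fuzzy_compl S (mu_prod S \<Gamma> op (fuzzy_compl S f) (fuzzy_compl S g)) a"
  proof (cases "a \<in> S \<and> (\<exists>b\<in>S. \<exists>c\<in>S. \<exists>\<beta>\<in>\<Gamma>. a = op b \<beta> c)")
    case True
    let ?X = "{min (fuzzy_compl S f b) (fuzzy_compl S g c) | b c \<beta>.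
      b \<in> S \<and> c \<in> S \<and> \<beta> \<in> \<Gamma> \<and> a = op b \<beta> c}"
    let ?Y = "{max (f b) (g c) | b c \<beta>. b \<in> S \<and> c \<in> S \<and> \<beta> \<in> \<Gamma> \<and> a = op b \<beta> c}"
    have "max (f b) (g c) = 1 - min (fuzzy_compl S f b) (fuzzy_compl S g c)"
      if "b \<in> S" "c \<in> S" for b c
      using that by (simp add: fuzzy_compl_def min_def max_def)
    then have "?Y = (-) 1 ` ?X"
      by (auto simp: image_iff) metis+
    moreover have "?X \<noteq> {}"
      using True by blast
    moreover have "bdd_above ?X"
      using f by (intro bdd_aboveI[of _ 1]) (auto simp: Pi_iff min_le_iff_disj fuzzy_compl_def)
    ultimately have "Inf ?Y = 1 - Sup ?X"
      by (simp add: one_minus_Sup)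
    then show ?thesis
      \<comment> \<open>The instantiation unfolds only the outer complement; the inner ones stay
        folded and so match \<open>?X\<close>.\<close>
      using True by (auto simp: gamma_prod_def mu_prod_def fuzzy_compl_def[of S "restrict _ _"])
  next
    case False
    then show ?thesis
      by (auto simp: gamma_prod_def mu_prod_def fuzzy_compl_def)
  qed
qed

context gamma_AG_star_star_groupoid
begin

text \<open>Stated for a single function, so that it applies both to the membership function and to
  the complement of the non-membership function.\<close>

definition interior_fun :: "('s \<Rightarrow> real) \<Rightarrow> bool" where
  "interior_fun f \<longleftrightarrow>
    (\<forall>x\<in>S. \<forall>a\<in>S. \<forall>y\<in>S. \<forall>\<alpha>\<in>\<Gamma>. \<forall>\<beta>\<in>\<Gamma>. f a \<le> f (op (op x \<alpha> a) \<beta> y))"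

text \<open>Since 1 is neutral for min on [0,1], \<open>?P a\<close> is the supremum of
  \<open>f e\<close> over all factorizations a = (d e) c, or 0 if there are none. Being interior
  means that each such \<open>f e\<close> is at most \<open>f a\<close>.\<close>

lemma interior_fun_iff_mu_prod:
  assumes "intra_regular S \<Gamma> op" and f: "f \<in> S \<rightarrow>\<^sub>E {0..1}"
  shows "interior_fun f \<longleftrightarrow>
    mu_prod S \<Gamma> op (mu_prod S \<Gamma> op (\<lambda>x\<in>S. 1) f) (\<lambda>x\<in>S. 1) = f"
    (is "_ \<longleftrightarrow> ?P = f")
proof -
  have one: "(\<lambda>x\<in>S. 1) \<in> S \<rightarrow> {0..1::real}"
    by simp
  have f': "f \<in> S \<rightarrow> {0..1}"
    using f by auto
  let ?Q = "mu_prod S \<Gamma> op (\<lambda>x\<in>S. 1) f"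
  have Q: "?Q \<in> S \<rightarrow> {0..1}"
    using mu_prod_in_unit_interval[OF one f'] by auto
  have P: "?P \<in> S \<rightarrow>\<^sub>E {0..1}"
    by (rule mu_prod_in_unit_interval[OF Q one])
  \<comment> \<open>This does not assume that \<open>f\<close> is interior, so it serves both
    directions of the equivalence.\<close>
  have upper: "f a \<le> ?P (op (op x \<alpha> a) \<beta> y)"
    if "x \<in> S" "a \<in> S" "y \<in> S" "\<alpha> \<in> \<Gamma>" "\<beta> \<in> \<Gamma>" for x a y \<alpha> \<beta>
  proof -
    have xa: "op x \<alpha> a \<in> S" "op (op x \<alpha> a) \<beta> y \<in> S"
      using that op_closed by auto
    have "f a \<le> ?Q (op x \<alpha> a)"
      using mu_prod_upper[of op x \<alpha> a S \<Gamma> "\<lambda>x\<in>S. 1" f] that f' xa one by (auto simp: Pi_iff)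
    also have "\<dots> \<le> ?P (op (op x \<alpha> a) \<beta> y)"
      using mu_prod_upper[of op "op x \<alpha> a" \<beta> y S \<Gamma> ?Q "\<lambda>x\<in>S. 1"] Q xa that(3,5)
      by (auto simp: Pi_iff)
    finally show ?thesis .
  qed
  show ?thesis
  proof
    assume "?P = f"
    then show "interior_fun f"
      using upper unfolding interior_fun_def by simp
  next
    assume int: "interior_fun f"
    have "?P a = f a" if a: "a \<in> S" for a
    proof (rule antisym)
      \<comment> \<open>Handles the default value 0 in both nested uses of
        \<open>mu_prod_least\<close>.\<close>
      have fa: "0 \<le> f a"
        using a f' by (auto simp: Pi_iff)
      show "?P a \<le> f a"
      proof (rule mu_prod_least[OF a fa])
        fix b c \<beta> assume bc: "b \<in> S" "c \<in> S" "\<beta> \<in> \<Gamma>" "a = op b \<beta> c"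
        have "?Q b \<le> f a"
        proof (rule mu_prod_least[OF bc(1) fa])
          fix d e \<alpha> assume "d \<in> S" "e \<in> S" "\<alpha> \<in> \<Gamma>" "b = op d \<alpha> e"
          then show "min ((\<lambda>x\<in>S. 1) d) (f e) \<le> f a"
            using int bc unfolding interior_fun_def by (simp add: min_le_iff_disj)
        qed
        then show "min (?Q b) ((\<lambda>x\<in>S. 1) c) \<le> f a"
          by (simp add: min_le_iff_disj)
      qed
    next
      obtain x y \<alpha> \<beta> \<gamma> where xy: "x \<in> S" "y \<in> S" "\<alpha> \<in> \<Gamma>" "\<beta> \<in> \<Gamma>" "\<gamma> \<in> \<Gamma>"
        and eq: "a = op (op x \<alpha> (op a \<beta> a)) \<gamma> y"
        using assms(1) a unfolding intra_regular_def by blast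
      \<comment> \<open>\<open>star_star\<close> exchanges \<open>x\<close> with the first inner
        \<open>a\<close>; the left invertive law then exchanges that \<open>a\<close> with
        \<open>y\<close>.\<close>
      have "a = op (op a \<alpha> (op x \<beta> a)) \<gamma> y"
        using eq star_star xy a by simp
      also have "\<dots> = op (op y \<alpha> (op x \<beta> a)) \<gamma> a"
        using left_invertive xy a op_closed by simp
      \<comment> \<open>Substituting for the left factor puts \<open>a\<close> in the middle
        position that the interior condition requires.\<close>
      finally have "op a \<beta> a = op (op (op y \<alpha> (op x \<beta> a)) \<gamma> a) \<beta> a"
        by simp
      then have "f a \<le> f (op a \<beta> a)"
        using int xy a op_closed unfolding interior_fun_def by metis
      \<comment> \<open>Here the middle element is \<open>op a \<beta> a\<close>, as in the
        intra-regular factorization of \<open>a\<close>.\<close>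
      also have "\<dots> \<le> ?P a"
        using upper[of x "op a \<beta> a" y \<alpha> \<gamma>] xy a op_closed eq by simp
      finally show "f a \<le> ?P a" .
    qed
    then show "?P = f"
      using P f by (intro PiE_ext)
  qed
qed

text \<open>The membership equivalence applied to 1 - f: duality turns the constant 0 into 1 and the
  nested non-membership product into the complement of \<open>?P\<close>.\<close>

lemma interior_fun_compl_iff_gamma_prod:
  assumes "intra_regular S \<Gamma> op" and f: "f \<in> S \<rightarrow>\<^sub>E {0..1}"
  shows "interior_fun (fuzzy_compl S f) \<longleftrightarrow>
    gamma_prod S \<Gamma> op (gamma_prod S \<Gamma> op (\<lambda>x\<in>S. 0) f) (\<lambda>x\<in>S. 0) = f"
proof -
  have zero: "(\<lambda>x\<in>S. 0) \<in> S \<rightarrow> {0..1::real}"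
    and compl_zero: "fuzzy_compl S (\<lambda>x\<in>S. 0) = (\<lambda>x\<in>S. 1)"
    by (auto simp: fuzzy_compl_def)
  have f': "f \<in> S \<rightarrow> {0..1}"
    using f by auto
  have cf: "fuzzy_compl S f \<in> S \<rightarrow>\<^sub>E {0..1}"
    by (rule fuzzy_compl_in_unit_interval[OF f'])
  let ?Q = "mu_prod S \<Gamma> op (\<lambda>x\<in>S. 1) (fuzzy_compl S f)"
  let ?P = "mu_prod S \<Gamma> op ?Q (\<lambda>x\<in>S. 1)"
  have Q: "?Q \<in> S \<rightarrow>\<^sub>E {0..1}"
    using cf by (intro mu_prod_in_unit_interval) auto
  then have P: "?P \<in> S \<rightarrow>\<^sub>E {0..1}"
    by (intro mu_prod_in_unit_interval) auto
  have inner: "gamma_prod S \<Gamma> op (\<lambda>x\<in>S. 0) f = fuzzy_compl S ?Q"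
    using gamma_prod_eq_compl_mu_prod[OF zero f'] by (simp only: compl_zero)
  have "fuzzy_compl S ?Q \<in> S \<rightarrow> {0..1}"
    using fuzzy_compl_in_unit_interval[of ?Q S] Q by auto
  from gamma_prod_eq_compl_mu_prod[OF this zero]
  \<comment> \<open>The two complements meeting at the inner product cancel because
    \<open>?Q\<close> is extensional.\<close>
  have "gamma_prod S \<Gamma> op (fuzzy_compl S ?Q) (\<lambda>x\<in>S. 0) = fuzzy_compl S ?P"
    using Q by (simp add: compl_zero fuzzy_compl_fuzzy_compl PiE_iff)
  moreover have "fuzzy_compl S ?P = f \<longleftrightarrow> ?P = fuzzy_compl S f"
    using fuzzy_compl_fuzzy_compl[of ?P S] fuzzy_compl_fuzzy_compl[of f S] P f
    by (auto simp: PiE_iff)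
  ultimately show ?thesis
    using interior_fun_iff_mu_prod[OF assms(1) cf] inner by simp
qed

text \<open>Complementing reverses the inequality for \<open>snd A\<close>; closure keeps all
  arguments in \<open>S\<close>, where the restricted complement is 1 - t.\<close>

lemma if_interior_ideal_iff_interior_fun:
  assumes "is_ifs S A"
  shows "if_interior_ideal S \<Gamma> op A \<longleftrightarrow>
    interior_fun (fst A) \<and> interior_fun (fuzzy_compl S (snd A))"
  using assms op_closed unfolding if_interior_ideal_def interior_fun_def
  by (auto simp: fuzzy_compl_def)

end

theorem theorem3:
  fixes S :: "'s set" and \<Gamma> :: "'g set" and op :: "'s \<Rightarrow> 'g \<Rightarrow> 's \<Rightarrow> 's" and A :: "'s ifs"
  assumes "gamma_AG_star_star_groupoid S \<Gamma> op"
    and "intra_regular S \<Gamma> op"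
    and "is_ifs S A"
  shows "if_interior_ideal S \<Gamma> op A \<longleftrightarrow>
    ifs_prod S \<Gamma> op (ifs_prod S \<Gamma> op (ifs_delta S) A) (ifs_delta S) = A"
proof -
  interpret gamma_AG_star_star_groupoid S \<Gamma> op
    by (rule assms(1))
  have "fst A \<in> S \<rightarrow>\<^sub>E {0..1}" "snd A \<in> S \<rightarrow>\<^sub>E {0..1}"
    using assms(3) unfolding is_ifs_def by auto
  \<comment> \<open>Equality of pairs splits into its components, each settled by one of the two
    function-level equivalences.\<close>
  then show ?thesis
    by (simp add: if_interior_ideal_iff_interior_fun assms interior_fun_iff_mu_prod
        interior_fun_compl_iff_gamma_prod ifs_prod_def ifs_delta_def prod_eq_iff)
qed

end
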